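(* Let $q\in\mathbb{N}$ with $q\ge 3$ and let $A\subset\mathbb{Q}$ be a finite set with $\#A\ge 2$ and $\#(A-A)<q$. If $p\ge 2$ is an integer with $\gcd(p,q)=1$, then $$\sup_{\alpha\in\mathbb{R}}\#\big((D_p+\alpha)\cap K(q,A)\big)<+\infty.$$
   Context: $\mathbb{N}=\{1,2,3,\ldots\}$; $\#$ denotes cardinality; $A-A=\{a-a': a,a'\in A\}$ and $D_p+\alpha=\{x+\alpha:x\in D_p\}$. For an integer $q\ge 2$ and a finite set $A\subset\mathbb{Q}$, $K(q,A)=\big\{\sum_{i=1}^{\infty}\frac{a_i}{q^i}: a_i\in A\ \text{for all } i\in\mathbb{N}\big\}$. For an integer $p\ge 2$, $D_p=\bigcup_{n=1}^{\infty}\frac{\mathbb{Z}}{p^n}$, where $\frac{\mathbb{Z}}{p^n}=\{m/p^n: m\in\mathbb{Z}\}$ (the rational numbers having a finite $p$-ary expansion). *)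

theory Defs
  imports "HOL-Analysis.Analysis" "HOL-Library.Extended_Nat"
begin

text \<open>Cardinality with value \<open>\<infinity>\<close> on infinite sets (\<^const>\<open>card\<close> would return \<open>0\<close> there).\<close>

definition ecard :: "'a set \<Rightarrow> enat" where
  "ecard X = (if finite X then enat (card X) else \<infinity>)"

definition diff_set :: "'a::minus set \<Rightarrow> 'a set \<Rightarrow> 'a set" where
  "diff_set A B = {a - b | a b. a \<in> A \<and> b \<in> B}"

text \<open>Digits are indexed from \<open>0\<close>, so \<open>a i\<close> is the digit of \<open>1 / q ^ Suc i\<close>.\<close>

definition K :: "nat \<Rightarrow> real set \<Rightarrow> real set" where
  "K q A = {x. \<exists>a :: nat \<Rightarrow> real. (\<forall>i. a i \<in> A) \<and> (\<lambda>i. a i / real q ^ Suc i) sums x}"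

definition D :: "nat \<Rightarrow> real set" where
  "D p = (\<Union>n\<in>{1..}. {real_of_int m / real p ^ n | m :: int. True})"

end

theory Submission
  imports Defs "HOL-Number_Theory.Residues"
begin

text \<open>
  Two points of \<open>(D p + \<alpha>) \<inter> K q A\<close> differ by an element of \<open>D p\<close> that also lies in
  \<open>K q (A - A)\<close>.  So it is enough that \<open>D p \<inter> K q E\<close> is finite whenever \<open>E\<close> is a finite set of
  fewer than \<open>q\<close> rationals: its cardinality then bounds all the intersections at once.

  Let \<open>x = u / d\<close> be a point of \<open>D p \<inter> K q E\<close> in lowest terms.  The tails of its digit
  sequence are again points of \<open>K q E\<close>; if \<open>N\<close> clears the denominators of \<open>E\<close>, the
  \<open>k\<close>-th tail is \<open>q ^ k * x\<close> up to an element of \<open>\<int> / N\<close>, so all tails have denominator \<open>N * d\<close>.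
  Two facts about these tails compete.

  Arithmetic says that tails seldom repeat.  If the tails at \<open>j < k\<close> agree then \<open>d\<close> divides
  \<open>N * (q ^ (k - j) - 1)\<close>, and since all primes of \<open>d\<close> divide \<open>p\<close>, a form of lifting the
  exponent gives \<open>d \<le> N * R * (k - j)\<close> with \<open>R\<close> depending on \<open>p\<close> and \<open>q\<close> only
  (\<open>dvd_of_dvd_power_minus_one\<close>, \<open>multiplicative_order_lower_bound\<close>).

  Geometry says that they must repeat.  Distinct points with denominator \<open>N * d\<close> are at least
  \<open>1 / (N * d)\<close> apart, so a tail is determined by its first \<open>m\<close> digits once \<open>q ^ m\<close> exceeds
  a constant times \<open>d\<close>; by pigeonhole a repetition occurs among the first \<open>card E ^ m + 1\<close> tails
  (\<open>denominator_le_number_of_words\<close>).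

  Together, \<open>d\<close> is at most a constant times \<open>card E ^ m\<close> while \<open>q ^ m\<close> is comparable to \<open>d\<close>.
  As \<open>card E < q\<close>, this bounds \<open>m\<close>, hence \<open>d\<close>; and \<open>K q E\<close> is bounded, so only finitely many
  \<open>u / d\<close> remain.
\<close>

section \<open>Powers congruent to one\<close>

lemma geometric_sum_cong_length:
  fixes r s :: int
  assumes "s dvd r - 1"
  shows "s dvd (\<Sum>i<k. r ^ i) - int k"
proof -
  have "s dvd r ^ i - 1" for i
    using assms by (metis dvd_trans dvd_triv_left power_diff_1_eq)
  then have "s dvd (\<Sum>i<k. r ^ i - 1)"
    by (intro dvd_sum) auto
  then show ?thesis
    by (simp add: sum_subtractf)
qed

text \<open>
  Lifting the exponent, for all primes of \<open>p\<close> at once and without valuations.  The quotient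
  \<open>(r ^ k - 1) / (r - 1)\<close> is a geometric sum congruent to \<open>k\<close> modulo \<open>p\<^sup>2\<close>.  For \<open>k\<close> coprime
  to \<open>p\<close> it is therefore invisible to \<open>d\<close>; for \<open>k\<close> a prime divisor of \<open>p\<close> it is \<open>k\<close> times a
  number congruent to \<open>1\<close> modulo \<open>p\<close>.  Splitting off such primes from the exponent one at a time
  reaches the first case.  The square is what makes the second case work (already \<open>p = 2\<close> and
  \<open>r = 3\<close> violate the statement if only \<open>p\<close> divides \<open>r - 1\<close>).
\<close>

lemma dvd_of_dvd_power_minus_one:
  fixes d p r a :: int
  assumes "d dvd p ^ n" and "p\<^sup>2 dvd r - 1" and "d dvd a * (r ^ k - 1)"
  shows "d dvd a * (r - 1) * int k"
  using assms(2,3)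
proof (induction k arbitrary: r rule: less_induct)
  case (less k)
  have cop_d: "coprime d s" if "coprime p s" for s
    using that assms(1) by (meson coprime_divisors coprime_power_left_iff dvd_refl)
  have p_dvd: "p dvd r - 1"
    using less.prems(1) by (metis dvd_trans dvd_triv_left power2_eq_square)
  consider "k = 0" | "k > 0" "coprime p (int k)" | "k > 0" "\<not> coprime p (int k)"
    by blast
  then show ?case
  proof cases
    case 1
    then show ?thesis by simp
  next
    case 2
    let ?S = "\<Sum>i<k. r ^ i"
    have "p dvd ?S - int k"
      by (rule geometric_sum_cong_length[OF p_dvd])
    then have "coprime p ?S"
      using 2(2) by (metis cong_iff_dvd_diff cong_imp_coprime cong_sym coprime_commute)
    moreover have "d dvd ?S * (a * (r - 1))"
      using less.prems(2) by (simp add: power_diff_1_eq mult_ac)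
    ultimately have "d dvd a * (r - 1)"
      using cop_d coprime_dvd_mult_right_iff by blast
    then show ?thesis
      by simp
  next
    case 3
    then obtain c where c: "c dvd p" "c dvd int k" "\<not> is_unit c"
      by (auto elim: not_coprimeE)
    have "c \<noteq> 0"
      using c(2) 3(1) by auto
    then obtain l where "prime l" "l dvd c"
      using c(3) by (rule prime_divisorE)
    then have l: "prime l" "l dvd p" "l dvd int k"
      using c dvd_trans by auto
    define L where "L = nat l"
    have lL: "l = int L" "L > 1"
      using l(1) prime_gt_1_int[of l] by (auto simp: L_def)
    obtain k' where k': "k = L * k'"
      using l(3) lL by (auto elim!: dvdE simp: int_dvd_int_iff)
    have "k' < k"
      using k' lL(2) 3(1) by simp
    have pow: "r ^ k = (r ^ L) ^ k'"
      by (simp add: k' power_mult)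
    have sq: "p\<^sup>2 dvd r ^ L - 1"
      using less.prems(1) by (metis dvd_trans dvd_triv_left power_diff_1_eq)
    have IH: "d dvd a * (r ^ L - 1) * int k'"
      using less.IH[OF \<open>k' < k\<close> sq] less.prems(2) pow by simp
    obtain p' where p': "p = l * p'"
      using l(2) by (elim dvdE)
    obtain t where t: "(\<Sum>i<L. r ^ i) - int L = p\<^sup>2 * t"
      using geometric_sum_cong_length[OF less.prems(1), of L] by (elim dvdE)
    let ?U = "1 + p * (p' * t)"
    have "(\<Sum>i<L. r ^ i) = l * ?U"
      using t p' lL(1) by (simp add: power2_eq_square algebra_simps)
    then have "r ^ L - 1 = (r - 1) * (l * ?U)"
      by (simp add: power_diff_1_eq)
    then have "d dvd ?U * (a * (r - 1) * (l * int k'))"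
      using IH by (simp add: mult_ac)
    moreover have "coprime p ?U"
      by (metis coprime_add_one_right coprime_mult_left_iff add.commute)
    ultimately have "d dvd a * (r - 1) * (l * int k')"
      using cop_d coprime_dvd_mult_right_iff by blast
    then show ?thesis
      using k' lL(1) by simp
  qed
qed

text \<open>
  Euler's theorem replaces \<open>q\<close> by a power \<open>q ^ f\<close> congruent to \<open>1\<close> modulo \<open>p\<^sup>2\<close>, and
  \<open>R = q ^ f - 1\<close>.  With \<open>N = 1\<close> the statement says that the order of \<open>q\<close> modulo \<open>d\<close> is at
  least \<open>d / R\<close>.
\<close>

lemma multiplicative_order_lower_bound:
  fixes p q :: nat
  assumes "coprime p q" and "p \<ge> 2" and "q \<ge> 2"
  obtains R :: nat where
    "\<And>d n N k. d dvd p ^ n \<Longrightarrow> N > 0 \<Longrightarrow> k > 0 \<Longrightarrow>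
       int d dvd int N * (int q ^ k - 1) \<Longrightarrow> d \<le> N * R * k"
proof
  define f where "f = totient (p\<^sup>2)"
  have "f > 0"
    using assms by (simp add: f_def)
  have "[q ^ f = 1] (mod p\<^sup>2)"
    unfolding f_def using assms by (intro euler_theorem) (simp add: coprime_commute)
  then have "[int (q ^ f) = int 1] (mod int (p\<^sup>2))"
    by (simp only: cong_int_iff)
  then have sq: "(int p)\<^sup>2 dvd int q ^ f - 1"
    by (simp add: cong_iff_dvd_diff)
  have "q ^ f > 1"
    using \<open>f > 0\<close> assms by (intro one_less_power) auto
  then have R: "int (q ^ f - 1) = int q ^ f - 1" "q ^ f - 1 > 0"
    by (auto simp: of_nat_diff)
  fix d n N k :: nat
  assume d: "d dvd p ^ n" and "N > 0" "k > 0"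
    and dvd: "int d dvd int N * (int q ^ k - 1)"
  have "int q ^ k - 1 dvd (int q ^ k) ^ f - 1"
    by (metis dvd_triv_left power_diff_1_eq)
  then have "int d dvd int N * ((int q ^ f) ^ k - 1)"
    using dvd by (auto simp: mult.commute intro: dvd_trans simp flip: power_mult)
  then have "int d dvd int N * (int q ^ f - 1) * int k"
    using dvd_of_dvd_power_minus_one[OF _ sq, of "int d" n] d by (metis of_nat_dvd_iff of_nat_power)
  then have "d dvd N * (q ^ f - 1) * k"
    by (metis R(1) of_nat_dvd_iff of_nat_mult)
  then show "d \<le> N * (q ^ f - 1) * k"
    using \<open>N > 0\<close> \<open>k > 0\<close> R(2) by (intro dvd_imp_le) auto
qed

section \<open>Tails of digit expansions\<close>

definition tail :: "nat \<Rightarrow> (nat \<Rightarrow> real) \<Rightarrow> nat \<Rightarrow> real" where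
  "tail q e k = (\<Sum>i. e (k + i) / real q ^ Suc i)"

lemma expansion_majorant_sums:
  fixes q :: nat
  assumes "q \<ge> 2"
  shows "(\<lambda>i. B / real q ^ Suc i) sums (B / (real q - 1))"
proof -
  have "(\<lambda>i. (B / real q) * (1 / real q) ^ i) sums ((B / real q) * (1 / (1 - 1 / real q)))"
    using assms by (intro sums_mult geometric_sums) auto
  moreover have "(B / real q) * (1 / (1 - 1 / real q)) = B / (real q - 1)"
    using assms by (simp add: field_simps)
  ultimately show ?thesis
    by (simp only: power_Suc power_one_over times_divide_times_eq times_divide_eq_right mult_1_right
        divide_divide_eq_left)
qed

context
  fixes q :: nat and e :: "nat \<Rightarrow> real" and B :: real
  assumes q: "q \<ge> 2" and bounded: "\<And>i. \<bar>e i\<bar> \<le> B"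
begin

lemma summable_expansion: "summable (\<lambda>i. e (k + i) / real q ^ Suc i)"
  using bounded
  by (intro summable_comparison_test'[OF sums_summable[OF expansion_majorant_sums[OF q, of B]], of 0])
    (auto simp: abs_divide intro!: divide_right_mono)

lemma abs_tail_le: "\<bar>tail q e k\<bar> \<le> B"
proof -
  have maj: "(\<lambda>i. B / real q ^ Suc i) sums (B / (real q - 1))"
    by (rule expansion_majorant_sums[OF q])
  have le: "\<bar>e (k + i) / real q ^ Suc i\<bar> \<le> B / real q ^ Suc i" for i
    using bounded by (auto simp: abs_divide intro!: divide_right_mono)
  have sm: "summable (\<lambda>i. \<bar>e (k + i) / real q ^ Suc i\<bar>)"
    using le by (intro summable_comparison_test'[OF sums_summable[OF maj], of 0]) auto
  have "\<bar>tail q e k\<bar> \<le> (\<Sum>i. \<bar>e (k + i) / real q ^ Suc i\<bar>)"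
    unfolding tail_def by (rule summable_rabs[OF sm])
  also have "\<dots> \<le> B / (real q - 1)"
    using suminf_le[OF le sm sums_summable[OF maj]] sums_unique[OF maj] by simp
  also have "\<dots> \<le> B / 1"
    using q bounded[of 0] by (intro divide_left_mono) auto
  finally show ?thesis by simp
qed

lemma tail_split:
  "tail q e k = (\<Sum>i<m. e (k + i) / real q ^ Suc i) + tail q e (k + m) / real q ^ m"
proof -
  have "tail q e (k + m) / real q ^ m = (\<Sum>i. e (k + m + i) / real q ^ Suc i / real q ^ m)"
    unfolding tail_def by (rule suminf_divide[OF summable_expansion, symmetric])
  also have "\<dots> = (\<Sum>i. e (k + (i + m)) / real q ^ Suc (i + m))"
    by (simp add: power_add ac_simps)
  finally show ?thesis
    unfolding tail_def
    using suminf_split_initial_segment[OF summable_expansion, of k m] by simp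
qed

lemma shift_minus_tail_in_Ints:
  assumes "\<And>i. real N * e i \<in> \<int>"
  shows "real N * (real q ^ k * tail q e 0 - tail q e k) \<in> \<int>"
proof -
  have "real q ^ k * tail q e 0 - tail q e k = real q ^ k * (\<Sum>i<k. e i / real q ^ Suc i)"
    using tail_split[of 0 k] q by (simp add: algebra_simps)
  also have "\<dots> = (\<Sum>i<k. real q ^ (k - Suc i) * e i)"
    unfolding sum_distrib_left using q
    by (intro sum.cong refl) (simp add: power_diff del: power_Suc)
  finally have "real N * (real q ^ k * tail q e 0 - tail q e k)
      = (\<Sum>i<k. real q ^ (k - Suc i) * (real N * e i))"
    by (simp add: sum_distrib_left mult_ac)
  also have "\<dots> \<in> \<int>"
    by (intro Ints_sum Ints_mult Ints_power assms) auto
  finally show ?thesis .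
qed

text \<open>
  Tails with the same first \<open>m\<close> digits are at distance at most \<open>2 * B / q ^ m\<close>.  When this is
  below \<open>1 / (N * d)\<close>, the spacing of the points with denominator \<open>N * d\<close>, the two tails coincide.
\<close>

lemma tails_eq_if_words_eq:
  assumes int: "\<And>i. real N * real d * tail q e i \<in> \<int>"
    and large: "2 * B * real N * real d < real q ^ m"
    and pos: "N > 0" "d > 0"
    and words: "\<And>i. i < m \<Longrightarrow> e (j + i) = e (k + i)"
  shows "tail q e j = tail q e k"
proof -
  define z where "z = real N * real d * (tail q e j - tail q e k)"
  have "z \<in> \<int>"
    using Ints_diff[OF int[of j] int[of k]] by (simp add: z_def algebra_simps)
  have "(\<Sum>i<m. e (j + i) / real q ^ Suc i) = (\<Sum>i<m. e (k + i) / real q ^ Suc i)"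
    using words by (intro sum.cong) auto
  then have "tail q e j - tail q e k = (tail q e (j + m) - tail q e (k + m)) / real q ^ m"
    using tail_split[of j m] tail_split[of k m] by (simp add: diff_divide_distrib)
  moreover have "\<bar>tail q e (j + m) - tail q e (k + m)\<bar> \<le> 2 * B"
    using abs_tail_le[of "j + m"] abs_tail_le[of "k + m"] by linarith
  ultimately have "\<bar>tail q e j - tail q e k\<bar> \<le> 2 * B / real q ^ m"
    using q by (simp add: abs_divide divide_right_mono)
  then have "\<bar>z\<bar> \<le> real N * real d * (2 * B / real q ^ m)"
    unfolding z_def abs_mult by (intro mult_mono) auto
  also have "\<dots> < 1"
    using large q by (simp add: field_simps)
  finally have "z = 0"
    using \<open>z \<in> \<int>\<close> Ints_nonzero_abs_less1 by blast
  then show ?thesis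
    using pos by (simp add: z_def)
qed

end

section \<open>Bounding the denominators\<close>

text \<open>
  Among the first \<open>card E ^ m + 1\<close> tails two start with the same \<open>m\<close> digits, hence are equal,
  and a repetition of tails is a congruence \<open>q ^ k = q ^ j\<close> modulo \<open>d\<close>, up to the factor \<open>N\<close>.
\<close>

lemma denominator_le_number_of_words:
  fixes q d N R m :: nat and e :: "nat \<Rightarrow> real" and u :: int
  assumes q: "q \<ge> 2" and E: "finite E" and e: "\<And>i. e i \<in> E"
    and B: "\<And>a. a \<in> E \<Longrightarrow> \<bar>a\<bar> \<le> B" and N: "\<And>a. a \<in> E \<Longrightarrow> real N * a \<in> \<int>"
    and pos: "N > 0" "d > 0"
    and x: "tail q e 0 = of_int u / real d"
    and cop: "coprime u (int d)" "coprime d q"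
    and order: "\<And>k. k > 0 \<Longrightarrow> int d dvd int N * (int q ^ k - 1) \<Longrightarrow> d \<le> N * R * k"
    and large: "2 * B * real N * real d < real q ^ m"
  shows "d \<le> N * R * card E ^ m"
proof -
  have eB: "\<bar>e i\<bar> \<le> B" for i
    using B e by blast
  have shift: "real N * (real q ^ k * tail q e 0 - tail q e k) \<in> \<int>" for k
    using e N by (intro shift_minus_tail_in_Ints[OF q eB]) auto
  have tail_int: "real N * real d * tail q e k \<in> \<int>" for k
  proof -
    have "real N * real d * tail q e k =
      real N * real q ^ k * of_int u - real d * (real N * (real q ^ k * tail q e 0 - tail q e k))"
      using x pos by (simp add: field_simps)
    then show ?thesis
      using shift by (simp add: Ints_diff Ints_mult Ints_power)
  qed

  define word where "word k = map (\<lambda>i. e (k + i)) [0..<m]" for k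
  have "word ` {..card E ^ m} \<subseteq> {w. set w \<subseteq> E \<and> length w = m}"
    using e by (auto simp: word_def)
  then have "card (word ` {..card E ^ m}) \<le> card E ^ m"
    using E card_mono[OF finite_lists_length_eq[OF E, of m]] card_lists_length_eq[OF E, of m]
    by metis
  then have "\<not> inj_on word {..card E ^ m}"
    using card_image[of word "{..card E ^ m}"] by auto
  then obtain j k where jk: "j < k" "k \<le> card E ^ m" "word j = word k"
    unfolding inj_on_def by (metis atMost_iff linorder_neqE_nat)
  have "e (j + i) = e (k + i)" if "i < m" for i
    using jk(3) that by (auto simp: word_def)
  then have eq: "tail q e j = tail q e k"
    using tails_eq_if_words_eq[OF q eB tail_int large pos] by blast

  have "real N * (real q ^ k * tail q e 0 - tail q e k)
      - real N * (real q ^ j * tail q e 0 - tail q e j) \<in> \<int>"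
    by (intro Ints_diff shift)
  then have "real N * (real q ^ k - real q ^ j) * (of_int u / real d) \<in> \<int>"
    using eq x by (simp add: algebra_simps)
  then obtain z :: int where "real N * (real q ^ k - real q ^ j) * (of_int u / real d) = of_int z"
    by (auto elim: Ints_cases)
  then have "of_int (int N * (int q ^ k - int q ^ j) * u) = (of_int (z * int d) :: real)"
    using pos by (simp add: field_simps)
  then have "int N * (int q ^ k - int q ^ j) * u = z * int d"
    by (simp only: of_int_eq_iff)
  then have "int d dvd int N * (int q ^ k - int q ^ j) * u"
    by simp
  then have "int d dvd int N * (int q ^ k - int q ^ j)"
    using cop(1) by (simp add: coprime_commute coprime_dvd_mult_left_iff)
  moreover have "int q ^ k - int q ^ j = int q ^ j * (int q ^ (k - j) - 1)"
    using jk(1) by (simp add: algebra_simps flip: power_add)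
  ultimately have "int d dvd int q ^ j * (int N * (int q ^ (k - j) - 1))"
    by (simp add: mult_ac)
  then have "int d dvd int N * (int q ^ (k - j) - 1)"
    using cop(2) by (simp add: coprime_dvd_mult_right_iff)
  then have "d \<le> N * R * (k - j)"
    using jk(1) by (intro order) auto
  also have "\<dots> \<le> N * R * card E ^ m"
    using jk by (intro mult_le_mono) auto
  finally show ?thesis .
qed

lemma power_dominates_smaller_base:
  fixes c q C :: nat
  assumes "c < q"
  obtains m0 where "\<And>m. C * c ^ m \<ge> q ^ m \<Longrightarrow> m < m0"
proof -
  have "(\<lambda>m. (real c / real q) ^ m) \<longlonglongrightarrow> 0"
    using assms by (intro LIMSEQ_realpow_zero) auto
  then have "(\<lambda>m. real C * (real c / real q) ^ m) \<longlonglongrightarrow> 0"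
    by (rule tendsto_mult_right_zero)
  then have "eventually (\<lambda>m. real C * (real c / real q) ^ m < 1) sequentially"
    by (rule order_tendstoD) simp
  then obtain m0 where m0: "\<And>m. m \<ge> m0 \<Longrightarrow> real C * (real c / real q) ^ m < 1"
    by (auto simp: eventually_sequentially)
  show thesis
  proof
    fix m assume ge: "C * c ^ m \<ge> q ^ m"
    show "m < m0"
    proof (rule ccontr)
      assume "\<not> m < m0"
      then have "real C * real c ^ m < real q ^ m"
        using m0[of m] assms by (simp add: power_divide field_simps)
      then have "C * c ^ m < q ^ m"
        by (metis of_nat_less_iff of_nat_mult of_nat_power)
      then show False
        using ge by simp
    qed
  qed
qed

lemma common_denominator:
  fixes E :: "real set"
  assumes "finite E" and "E \<subseteq> \<rat>"
  obtains N :: nat where "N > 0" and "\<And>a. a \<in> E \<Longrightarrow> real N * a \<in> \<int>"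
proof -
  have "\<exists>N::nat. N > 0 \<and> (\<forall>a\<in>E. real N * a \<in> \<int>)"
    using assms
  proof (induction E rule: finite_induct)
    case empty
    then show ?case by auto
  next
    case (insert b E)
    then obtain N :: nat where N: "N > 0" "\<And>a. a \<in> E \<Longrightarrow> real N * a \<in> \<int>"
      by auto
    have "b \<in> \<rat>"
      using insert.prems by simp
    then obtain s t :: int where st: "t > 0" "b = of_int s / of_int t"
      by (auto elim: Rats_cases')
    have t: "real (nat t) = of_int t"
      using st by simp
    have "real (nat t * N) * a \<in> \<int>" if "a \<in> insert b E" for a
    proof (cases "a = b")
      case True
      have "real (nat t * N) * a = real N * of_int s"
        using True st t by simp
      then show ?thesis
        by (simp only: Ints_mult Ints_of_nat Ints_of_int)
    next
      case False
      then have "real N * a \<in> \<int>"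
        using that N(2) by simp
      then have "of_int t * (real N * a) \<in> \<int>"
        by (rule Ints_mult[OF Ints_of_int])
      then show ?thesis
        using t by (simp add: mult_ac)
    qed
    then show ?case
      using N st by (intro exI[of _ "nat t * N"]) auto
  qed
  then show thesis
    using that by blast
qed

lemma D_lowest_terms:
  assumes "x \<in> D p" and "p \<ge> 2"
  obtains u :: int and d n :: nat where
    "x = of_int u / real d" "coprime u (int d)" "d dvd p ^ n" "d > 0"
proof -
  obtain m :: int and n :: nat where mn: "x = of_int m / real p ^ n"
    using assms(1) by (auto simp: D_def)
  define g where "g = gcd m (int p ^ n)"
  have "p ^ n > 0"
    using assms(2) by simp
  then have "g > 0"
    using assms(2) by (simp add: g_def)
  obtain u v where uv: "m = u * g" "int p ^ n = v * g" "coprime u v"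
    using gcd_coprime_exists[of m "int p ^ n"] \<open>g > 0\<close> unfolding g_def by force
  have "v * g > 0"
    using \<open>p ^ n > 0\<close> uv(2) by (metis of_nat_0_less_iff of_nat_power)
  then have "v > 0"
    using \<open>g > 0\<close> by (simp add: zero_less_mult_iff)
  define d where "d = nat v"
  have d: "int d = v"
    using \<open>v > 0\<close> by (simp add: d_def)
  have "real p ^ n = of_int (v * g)"
    using uv(2) by (metis of_int_of_nat_eq of_int_power)
  then have "x = of_int u / real d"
    using mn uv(1) \<open>g > 0\<close> d by (metis mult_divide_mult_cancel_right of_int_eq_0_iff of_int_mult
        less_irrefl of_int_of_nat_eq)
  moreover have "int d dvd int (p ^ n)"
    using uv(2) d by simp
  then have "d dvd p ^ n"
    using of_nat_dvd_iff by blast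
  moreover have "coprime u (int d)" "d > 0"
    using uv(3) d \<open>v > 0\<close> by auto
  ultimately show thesis
    by (intro that)
qed

lemma finite_D_Int_K:
  fixes p q :: nat and E :: "real set"
  assumes "q \<ge> 2" and "p \<ge> 2" and "coprime p q"
    and "finite E" and "E \<subseteq> \<rat>" and "card E < q"
  shows "finite (D p \<inter> K q E)"
proof -
  obtain N :: nat where N: "N > 0" "\<And>a. a \<in> E \<Longrightarrow> real N * a \<in> \<int>"
    using common_denominator[OF assms(4,5)] by blast
  obtain B :: nat where B: "B > 0" "\<And>a. a \<in> E \<Longrightarrow> \<bar>a\<bar> \<le> real B"
  proof -
    obtain b where b: "\<And>a. a \<in> E \<Longrightarrow> \<bar>a\<bar> \<le> b"
      using finite_imp_bounded[OF assms(4)] by (auto simp: bounded_iff)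
    have "b \<le> real (nat \<lceil>b\<rceil> + 1)"
      using real_nat_ceiling_ge[of b] by simp
    then show thesis
      using b that[of "nat \<lceil>b\<rceil> + 1"] by (meson add_gr_0 order_trans zero_less_one)
  qed
  obtain R :: nat where R: "\<And>d n N k. d dvd p ^ n \<Longrightarrow> N > 0 \<Longrightarrow> k > 0 \<Longrightarrow>
      int d dvd int N * (int q ^ k - 1) \<Longrightarrow> d \<le> N * R * k"
    using multiplicative_order_lower_bound[OF assms(3,2,1)] by blast
  define C where "C = 2 * B * N"
  have "C > 0"
    using B N by (simp add: C_def)
  obtain m0 where m0: "\<And>m. C * (N * R * card E) * card E ^ m \<ge> q ^ m \<Longrightarrow> m < m0"
    using power_dominates_smaller_base[OF assms(6)] by blast

  have "\<exists>u d. x = of_int u / real d \<and> u \<in> {- int (B * q ^ m0)..int (B * q ^ m0)} \<and> d \<le> q ^ m0"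
    if x: "x \<in> D p \<inter> K q E" for x
  proof -
    obtain u :: int and d n :: nat
      where ud: "x = of_int u / real d" "coprime u (int d)" "d dvd p ^ n" "d > 0"
      using x D_lowest_terms[OF _ assms(2)] by blast
    obtain e where e: "\<And>i. e i \<in> E" "(\<lambda>i. e i / real q ^ Suc i) sums x"
      using x by (auto simp: K_def)
    have tail: "tail q e 0 = x"
      using sums_unique[OF e(2)] by (simp add: tail_def)
    have "coprime d q"
      using ud(3) assms(3) by (meson coprime_divisors coprime_power_left_iff dvd_refl)
    \<comment> \<open>The number of digits is chosen as small as the separation of points allows.\<close>
    obtain m where m: "q ^ m \<le> C * d" "C * d < q ^ (m + 1)"
      using ex_power_ivl1[OF assms(1), of "C * d"] \<open>C > 0\<close> ud(4) by auto
    have "real (C * d) < real (q ^ (m + 1))"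
      using m(2) by (simp only: of_nat_less_iff)
    then have "2 * real B * real N * real d < real q ^ (m + 1)"
      by (simp add: C_def mult_ac)
    then have "d \<le> N * R * card E ^ (m + 1)"
      using ud tail
      by (intro denominator_le_number_of_words[OF assms(1,4) e(1) B(2) N(2,1) ud(4) _ ud(2)
            \<open>coprime d q\<close> R[OF ud(3) N(1)]]) auto
    then have "C * d \<le> C * (N * R * card E) * card E ^ m"
      using mult_le_mono2[of d _ C] by (simp add: mult_ac)
    then have "m < m0"
      using m(1) by (intro m0) linarith
    then have "q ^ (m + 1) \<le> q ^ m0"
      using assms(1) by (intro power_increasing) auto
    moreover have "d \<le> C * d"
      using \<open>C > 0\<close> by simp
    ultimately have d: "d \<le> q ^ m0"
      using m(2) by linarith
    have "\<bar>x\<bar> \<le> real B"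
      using abs_tail_le[OF assms(1), of e "real B" 0] B(2) e(1) tail by auto
    then have "\<bar>real_of_int u\<bar> \<le> real B * real d"
      using ud(1,4) by (simp add: abs_divide field_simps)
    also have "\<dots> \<le> real B * real (q ^ m0)"
      using d by (intro mult_left_mono) (simp_all only: of_nat_le_iff of_nat_0_le_iff)
    finally have "\<bar>u\<bar> \<le> int (B * q ^ m0)"
      by (metis of_int_abs of_int_le_iff of_int_of_nat_eq of_nat_mult)
    then show ?thesis
      using ud(1) d by (intro exI[of _ u] exI[of _ d]) (auto simp: abs_le_iff)
  qed
  then have "D p \<inter> K q E \<subseteq> (\<lambda>(u, d). of_int u / real d) `
      ({- int (B * q ^ m0)..int (B * q ^ m0)} \<times> {..q ^ m0})"
    by force
  then show ?thesis
    by (rule finite_subset) auto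
qed

section \<open>Differences\<close>

lemma diff_in_D:
  assumes "x \<in> D p" and "y \<in> D p" and "p > 0"
  shows "x - y \<in> D p"
proof -
  obtain a b :: int and m n :: nat where
    *: "m \<ge> 1" "x = of_int a / real p ^ m" "y = of_int b / real p ^ n"
    using assms(1,2) by (auto simp: D_def)
  have "x - y = of_int (a * int p ^ n - b * int p ^ m) / real p ^ (m + n)"
    using * assms(3) by (simp add: diff_divide_distrib power_add)
  moreover have "m + n \<ge> 1"
    using * by simp
  ultimately show ?thesis
    unfolding D_def by blast
qed

lemma diff_in_K:
  assumes "x \<in> K q A" and "y \<in> K q A"
  shows "x - y \<in> K q (diff_set A A)"
proof -
  obtain a b where
    *: "\<And>i. a i \<in> A" "(\<lambda>i. a i / real q ^ Suc i) sums x"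
       "\<And>i. b i \<in> A" "(\<lambda>i. b i / real q ^ Suc i) sums y"
    using assms by (auto simp: K_def)
  have "(\<lambda>i. (a i - b i) / real q ^ Suc i) sums (x - y)"
    using sums_diff[OF *(2,4)] by (simp add: diff_divide_distrib)
  moreover have "a i - b i \<in> diff_set A A" for i
    using * by (auto simp: diff_set_def)
  ultimately show ?thesis
    unfolding K_def by (intro CollectI exI[of _ "\<lambda>i. a i - b i"]) auto
qed

theorem theorem1p4:
  fixes q p :: nat and A :: "real set"
  assumes "q \<ge> 3"
    and "finite A" and "A \<subseteq> \<rat>"
    and "card A \<ge> 2"
    and "card (diff_set A A) < q"
    and "p \<ge> 2"
    and "coprime p q"
  shows "(SUP \<alpha> :: real. ecard ((\<lambda>x. x + \<alpha>) ` D p \<inter> K q A)) < \<infinity>"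
proof -
  have im: "diff_set A A = (\<lambda>(a, b). a - b) ` (A \<times> A)"
    by (auto simp: diff_set_def)
  have "diff_set A A \<subseteq> \<rat>"
    using assms(3) unfolding diff_set_def by (blast intro: Rats_diff)
  then have fin: "finite (D p \<inter> K q (diff_set A A))" (is "finite ?F")
    using assms im by (intro finite_D_Int_K) auto
  have "ecard ((\<lambda>x. x + \<alpha>) ` D p \<inter> K q A) \<le> enat (card ?F)" for \<alpha>
  proof (cases "(\<lambda>x. x + \<alpha>) ` D p \<inter> K q A = {}")
    case True
    then show ?thesis
      by (simp add: ecard_def)
  next
    case False
    then obtain y where y: "y \<in> (\<lambda>x. x + \<alpha>) ` D p" "y \<in> K q A"
      by auto
    have "z - y \<in> ?F" if "z \<in> (\<lambda>x. x + \<alpha>) ` D p \<inter> K q A" for z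
      using that y diff_in_D[of _ p] diff_in_K[of z q A y] assms(6) by fastforce
    then have sub: "(\<lambda>x. x + \<alpha>) ` D p \<inter> K q A \<subseteq> (\<lambda>w. w + y) ` ?F"
      by (force intro: rev_image_eqI[where x = "_ - y"])
    have "finite ((\<lambda>x. x + \<alpha>) ` D p \<inter> K q A)"
      using finite_subset[OF sub] fin by simp
    moreover have "card ((\<lambda>x. x + \<alpha>) ` D p \<inter> K q A) \<le> card ?F"
      using card_mono[OF _ sub] card_image_le[OF fin] fin by (meson finite_imageI order_trans)
    ultimately show ?thesis
      by (simp add: ecard_def)
  qed
  then have "(SUP \<alpha>. ecard ((\<lambda>x. x + \<alpha>) ` D p \<inter> K q A)) \<le> enat (card ?F)"
    by (intro SUP_least)
  then show ?thesis
    using order_le_less_trans enat_ord_simps(4) by blast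
qed

end
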